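(* Let $A$ be a graded superring, $B$ a graded subring, $\alpha$ an automorphism of $A$, $\beta$ an automorphism of $B$, $\lambda\in\Lambda$, $\pi\in\mathbb{Z}_2$. Let $A$ be an $(\alpha,\beta)$-Frobenius extension of $B$ of degree $(-\lambda,\pi)$ and let $$\Phi\colon{}_AA_B\to\mathrm{HOM}^{\mathrm L}_B\big({}^{\beta}_{B}A^{\alpha}_{A},\{\lambda,\pi\}{}_BB_B\big)$$ be an isomorphism of $(A,B)$-bimodules. Then a second map $$\Phi'\colon{}_AA_B\to\mathrm{HOM}^{\mathrm L}_B\big({}^{\beta}_{B}A^{\alpha}_{A},\{\lambda,\pi\}{}_BB_B\big)$$ is an isomorphism of $(A,B)$-bimodules if and only if there is an invertible element $\mu\in A_{0,0}$ that commutes with all elements of $B$ and such that $$\Phi^{-1}\Phi'(a)=a\mu\quad\text{for all }a\in A.$$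
   Context: Fix an abelian group $\Lambda$. A graded superring is an associative unital $\Lambda\times\mathbb{Z}_2$-graded ring; subrings are graded (with the same unit), automorphisms preserve the grading, and modules and bimodules are $\Lambda\times\mathbb{Z}_2$-graded. For homogeneous $v$, $|v|\in\Lambda$ and $\bar v\in\mathbb{Z}_2$ denote its degrees; formulas involving degrees are stated for homogeneous elements and extended additively. Homomorphisms of modules and bimodules are additive maps of degree $(0,0)$ commuting strictly with the actions. Shifts: $\{\mu,\gamma\}M$ is $M$ as an abelian group, with $(\{\mu,\gamma\}M)_{\nu,\delta}=M_{\nu-\mu,\delta+\gamma}$, unchanged right action, and left action $a\cdot\{\mu,\gamma\}m=(-1)^{\gamma\bar a}\{\mu,\gamma\}(am)$. Twists: ${}^{\beta}_{B}A^{\alpha}_{A}$ is $A$ as a graded abelian group with $b\cdot x=\beta(b)x$ ($b\in B$) and $x\cdot a=x\alpha(a)$ ($a\in A$). ${}_AA_B$, ${}_BB_B$ carry the multiplication actions. $\mathrm{HOM}^{\mathrm L}_B({}^{\beta}_{B}A^{\alpha}_{A},\{\lambda,\pi\}{}_BB_B)$ is the direct sum over $(\mu,\gamma)\in\Lambda\times\mathbb{Z}_2$ of the groups of additive maps $f\colon A\to\{\lambda,\pi\}B$ of degree $(\mu,\gamma)$ with $f(\beta(b)x)=(-1)^{\gamma\bar b}\,b\cdot f(x)$ (action in $\{\lambda,\pi\}B$). It is an $(A,B)$-bimodule via $(a\cdot f)(x)=(-1)^{\bar a\bar f+\bar a\bar x}f(x\alpha(a))$ and $(f\cdot b)(x)=(-1)^{\bar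 b\bar x}f(x)b$. $A$ is an $(\alpha,\beta)$-Frobenius extension of $B$ of degree $(-\lambda,\pi)$ if (L1) $A$ is finitely generated and projective as a left $B$-module, and (L2) ${}_AA_B\cong\mathrm{HOM}^{\mathrm L}_B({}^{\beta}_{B}A^{\alpha}_{A},\{\lambda,\pi\}{}_BB_B)$ as $(A,B)$-bimodules. *)

theory Defs
  imports "HOL-Algebra.Subrings" "HOL-Library.Product_Plus" "HOL-Library.Z2"
begin

text \<open>
  The grading group is the additive group of the type \<^typ>\<open>'l \<times> bit\<close>, where \<open>'l\<close> is an
  arbitrary abelian group (playing the role of \<open>\<Lambda>\<close>) and \<^typ>\<open>bit\<close> is the field with two elements.
  The same record is used for graded rings and for graded abelian groups; as for
  modules in HOL-Algebra, the fields \<open>mult\<close> and \<open>one\<close> of a graded group that is not a ring are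
  meaningless.
\<close>

record ('a, 'l) graded = "'a ring" +
  gpart :: "'l \<times> bit \<Rightarrow> 'a set"

record ('m, 'l, 'r) gmodule = "('m, 'l) graded" +
  lact :: "'r \<Rightarrow> 'm \<Rightarrow> 'm"

record ('m, 'l, 'r, 's) gbimodule = "('m, 'l, 'r) gmodule" +
  ract :: "'m \<Rightarrow> 's \<Rightarrow> 'm"


section \<open>Graded abelian groups\<close>

definition homog_decomp ::
    "('a, 'l, 'x) graded_scheme \<Rightarrow> 'a \<Rightarrow> ('l \<times> bit \<Rightarrow> 'a) \<Rightarrow> bool" where
  "homog_decomp M x c \<longleftrightarrow>
     (\<forall>d. c d \<in> gpart M d) \<and> finite {d. c d \<noteq> \<zero>\<^bsub>M\<^esub>} \<and> x = (\<Oplus>\<^bsub>M\<^esub>d\<in>{d. c d \<noteq> \<zero>\<^bsub>M\<^esub>}. c d)"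

locale graded_group = abelian_group M for M :: "('a, 'l::ab_group_add, 'x) graded_scheme" (structure) +
  assumes gpart_subgroup: "additive_subgroup (gpart M d) M"
    and unique_decomp: "x \<in> carrier M \<Longrightarrow> \<exists>!c. homog_decomp M x c"

definition gcomp :: "('a, 'l, 'x) graded_scheme \<Rightarrow> 'a \<Rightarrow> 'l \<times> bit \<Rightarrow> 'a" where
  "gcomp M x = (THE c. homog_decomp M x c)"

text \<open>
  Additive extension of a formula stated for homogeneous elements only: \<open>F d x\<close> is the value of
  the formula at \<open>x\<close> of degree \<open>d\<close>, an element of the abelian group \<open>N\<close>.
\<close>

definition add_extend ::
    "('a, 'l, 'x) graded_scheme \<Rightarrow> ('n, 'y) ring_scheme \<Rightarrow> ('l \<times> bit \<Rightarrow> 'a \<Rightarrow> 'n) \<Rightarrow> 'a \<Rightarrow> 'n" where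
  "add_extend M N F x = (\<Oplus>\<^bsub>N\<^esub>d\<in>{d. gcomp M x d \<noteq> \<zero>\<^bsub>M\<^esub>}. F d (gcomp M x d))"

lemma (in graded_group) add_extend_homog:
  assumes "x \<in> gpart M d" and "F d x \<in> carrier N" and "abelian_monoid N"
    and zero: "F d \<zero> = \<zero>\<^bsub>N\<^esub>"
  shows "add_extend M N F x = F d x"
proof -
  interpret N: abelian_monoid N by fact
  interpret additive_subgroup "gpart M d" M by (rule gpart_subgroup)
  have x: "x \<in> carrier M"
    using assms(1) a_Hcarr by blast
  define c where "c = (\<lambda>e. if e = d then x else \<zero>)"
  have supp: "{e. c e \<noteq> \<zero>} = (if x = \<zero> then {} else {d})"
    by (auto simp: c_def)
  have zero_mem: "\<zero> \<in> gpart M e" for e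
    using gpart_subgroup[of e] additive_subgroup.zero_closed by blast
  have "(\<Oplus>e\<in>{e. c e \<noteq> \<zero>}. c e) = x"
    unfolding supp using x by (simp add: c_def)
  moreover have "\<forall>e. c e \<in> gpart M e"
    using assms(1) zero_mem by (simp add: c_def)
  ultimately have "homog_decomp M x c"
    by (simp add: homog_decomp_def supp)
  then have "gcomp M x = c"
    unfolding gcomp_def using unique_decomp[OF x] by (blast intro: the1_equality)
  then have "add_extend M N F x = (\<Oplus>\<^bsub>N\<^esub>e\<in>(if x = \<zero> then {} else {d}). F e (c e))"
    by (simp add: add_extend_def supp)
  also have "\<dots> = F d x"
    using assms(2) zero by (simp add: c_def)
  finally show ?thesis .
qed

text \<open>The element \<open>(-1)\<^sup>\<epsilon> x\<close>.\<close>

definition sgn_act :: "('n, 'y) ring_scheme \<Rightarrow> bit \<Rightarrow> 'n \<Rightarrow> 'n" where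
  "sgn_act N \<epsilon> x = (if \<epsilon> = 0 then x else \<ominus>\<^bsub>N\<^esub> x)"

definition homog_map ::
    "('m, 'l::ab_group_add, 'x) graded_scheme \<Rightarrow> ('n, 'l, 'y) graded_scheme \<Rightarrow> 'l \<times> bit \<Rightarrow>
      ('m \<Rightarrow> 'n) set" where
  "homog_map M N d =
     {f \<in> hom (add_monoid M) (add_monoid N). \<forall>e. f ` gpart M e \<subseteq> gpart N (e + d)}"


section \<open>Graded superrings\<close>

locale graded_superring = ring A + graded_group A
    for A :: "('a, 'l::ab_group_add, 'x) graded_scheme" (structure) +
  assumes one_homog: "\<one> \<in> gpart A 0"
    and mult_homog: "\<lbrakk>a \<in> gpart A d; b \<in> gpart A e\<rbrakk> \<Longrightarrow> a \<otimes> b \<in> gpart A (d + e)"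

text \<open>The subset \<open>B\<close> of \<open>A\<close> with the inherited operations and grading \<open>B\<^sub>d = A\<^sub>d \<inter> B\<close>.\<close>

definition grestrict :: "('a, 'l, 'x) graded_scheme \<Rightarrow> 'a set \<Rightarrow> ('a, 'l, 'x) graded_scheme" where
  "grestrict A B = A\<lparr>carrier := B, gpart := \<lambda>d. gpart A d \<inter> B\<rparr>"

definition graded_subring :: "'a set \<Rightarrow> ('a, 'l::ab_group_add, 'x) graded_scheme \<Rightarrow> bool" where
  "graded_subring B A \<longleftrightarrow> subring B A \<and> graded_superring (grestrict A B)"

definition graded_automorphisms :: "('a, 'l::ab_group_add, 'x) graded_scheme \<Rightarrow> ('a \<Rightarrow> 'a) set" where
  "graded_automorphisms A = ring_iso A A \<inter> homog_map A A 0"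


section \<open>Graded modules and bimodules\<close>

locale graded_left_module = R?: graded_superring R + M?: graded_group M
    for R :: "('r, 'l::ab_group_add, 'x) graded_scheme" (structure)
    and M :: "('m, 'l, 'r, 'y) gmodule_scheme" (structure) +
  assumes lact_closed: "\<lbrakk>r \<in> carrier R; x \<in> carrier M\<rbrakk> \<Longrightarrow> lact M r x \<in> carrier M"
    and lact_homog: "\<lbrakk>r \<in> gpart R d; x \<in> gpart M e\<rbrakk> \<Longrightarrow> lact M r x \<in> gpart M (d + e)"
    and lact_add_left: "\<lbrakk>r \<in> carrier R; s \<in> carrier R; x \<in> carrier M\<rbrakk>
      \<Longrightarrow> lact M (r \<oplus>\<^bsub>R\<^esub> s) x = lact M r x \<oplus>\<^bsub>M\<^esub> lact M s x"
    and lact_add_right: "\<lbrakk>r \<in> carrier R; x \<in> carrier M; y \<in> carrier M\<rbrakk>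
      \<Longrightarrow> lact M r (x \<oplus>\<^bsub>M\<^esub> y) = lact M r x \<oplus>\<^bsub>M\<^esub> lact M r y"
    and lact_mult: "\<lbrakk>r \<in> carrier R; s \<in> carrier R; x \<in> carrier M\<rbrakk>
      \<Longrightarrow> lact M (r \<otimes>\<^bsub>R\<^esub> s) x = lact M r (lact M s x)"
    and lact_one: "x \<in> carrier M \<Longrightarrow> lact M \<one>\<^bsub>R\<^esub> x = x"

definition gmodule_hom ::
    "('r, 'l::ab_group_add, 'x) graded_scheme \<Rightarrow> ('m, 'l, 'r, 'y) gmodule_scheme \<Rightarrow>
      ('n, 'l, 'r, 'z) gmodule_scheme \<Rightarrow> ('m \<Rightarrow> 'n) set" where
  "gmodule_hom R M N =
     {f \<in> homog_map M N 0. \<forall>r\<in>carrier R. \<forall>x\<in>carrier M. f (lact M r x) = lact N r (f x)}"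

definition gbimodule_hom ::
    "('r, 'l::ab_group_add, 'x) graded_scheme \<Rightarrow> ('s, 'l, 'y) graded_scheme \<Rightarrow>
      ('m, 'l, 'r, 's) gbimodule \<Rightarrow> ('n, 'l, 'r, 's) gbimodule \<Rightarrow> ('m \<Rightarrow> 'n) set" where
  "gbimodule_hom R S M N =
     {f \<in> gmodule_hom R M N. \<forall>x\<in>carrier M. \<forall>s\<in>carrier S. f (ract M x s) = ract N (f x) s}"

definition gbimodule_iso ::
    "('r, 'l::ab_group_add, 'x) graded_scheme \<Rightarrow> ('s, 'l, 'y) graded_scheme \<Rightarrow>
      ('m, 'l, 'r, 's) gbimodule \<Rightarrow> ('n, 'l, 'r, 's) gbimodule \<Rightarrow> ('m \<Rightarrow> 'n) set" where
  "gbimodule_iso R S M N = {f \<in> gbimodule_hom R S M N. bij_betw f (carrier M) (carrier N)}"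

definition fin_gen_module ::
    "('r, 'l, 'x) graded_scheme \<Rightarrow> ('m, 'l, 'r, 'y) gmodule_scheme \<Rightarrow> bool" where
  "fin_gen_module R P \<longleftrightarrow>
     (\<exists>S. finite S \<and> S \<subseteq> carrier P \<and>
        (\<forall>x\<in>carrier P. \<exists>c\<in>S \<rightarrow> carrier R. x = (\<Oplus>\<^bsub>P\<^esub>s\<in>S. lact P (c s) s)))"

text \<open>
  Lifting property against all surjections of graded left modules. A definition cannot quantify
  over types, so the test modules have their carriers in the type \<^typ>\<open>'m \<Rightarrow> 'r\<close>. This is no loss:
  \<open>P\<close> itself and the free graded module on the homogeneous elements of \<open>P\<close> (finitely supported
  functions from \<open>P\<close> to \<open>R\<close>) both embed in this type, and splitting the canonical surjection from
  the latter to \<open>P\<close> already makes \<open>P\<close> projective.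
\<close>

definition projective_module ::
    "('r, 'l::ab_group_add, 'x) graded_scheme \<Rightarrow> ('m, 'l, 'r, 'y) gmodule_scheme \<Rightarrow> bool" where
  "projective_module R P \<longleftrightarrow>
     (\<forall>(M :: ('m \<Rightarrow> 'r, 'l, 'r) gmodule) (N :: ('m \<Rightarrow> 'r, 'l, 'r) gmodule) g f.
        graded_left_module R M \<and> graded_left_module R N \<and>
        g \<in> gmodule_hom R M N \<and> g ` carrier M = carrier N \<and> f \<in> gmodule_hom R P N \<longrightarrow>
        (\<exists>h\<in>gmodule_hom R P M. \<forall>x\<in>carrier P. g (h x) = f x))"

text \<open>
  \<open>A\<close> with its multiplication actions. Scalars are not recorded here: restricting them to a subring
  \<open>B\<close> only changes the ring passed to the notions that quantify over scalars.
\<close>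

definition mult_bimodule :: "('a, 'l) graded \<Rightarrow> ('a, 'l, 'a, 'a) gbimodule" where
  "mult_bimodule A =
     \<lparr>carrier = carrier A, mult = mult A, one = one A, zero = zero A, add = add A,
      gpart = gpart A, lact = mult A, ract = mult A\<rparr>"

definition twisted_bimodule ::
    "('a, 'l) graded \<Rightarrow> ('a \<Rightarrow> 'a) \<Rightarrow> ('a \<Rightarrow> 'a) \<Rightarrow> ('a, 'l, 'a, 'a) gbimodule" where
  "twisted_bimodule A \<beta> \<alpha> =
     (mult_bimodule A)\<lparr>lact := \<lambda>b x. \<beta> b \<otimes>\<^bsub>A\<^esub> x, ract := \<lambda>x a. x \<otimes>\<^bsub>A\<^esub> \<alpha> a\<rparr>"

text \<open>The shift \<open>{\<mu>, \<gamma>}M\<close>; \<open>R\<close> is the ring acting on \<open>M\<close> from the left.\<close>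

definition shift ::
    "('r, 'l::ab_group_add, 'x) graded_scheme \<Rightarrow> 'l \<Rightarrow> bit \<Rightarrow> ('m, 'l, 'r, 's) gbimodule \<Rightarrow>
      ('m, 'l, 'r, 's) gbimodule" where
  "shift R \<mu> \<gamma> M =
     M\<lparr>gpart := \<lambda>(\<nu>, \<delta>). gpart M (\<nu> - \<mu>, \<delta> + \<gamma>),
       lact := \<lambda>a m. add_extend R M (\<lambda>d a'. sgn_act M (\<gamma> * snd d) (lact M a' m)) a\<rparr>"


section \<open>The bimodule of left module homomorphisms\<close>

definition homL_part ::
    "('r, 'l::ab_group_add, 'x) graded_scheme \<Rightarrow> ('m, 'l, 'r, 'y) gmodule_scheme \<Rightarrow>
      ('n, 'l, 'r, 'z) gmodule_scheme \<Rightarrow> 'l \<times> bit \<Rightarrow> ('m \<Rightarrow> 'n) set" where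
  "homL_part R M N d =
     {f \<in> homog_map M N d \<inter> extensional (carrier M).
        \<forall>e. \<forall>r\<in>gpart R e. \<forall>x\<in>carrier M.
          f (lact M r x) = sgn_act N (snd d * snd e) (lact N r (f x))}"

text \<open>
  The group of all additive maps with the subgroups \<^const>\<open>homL_part\<close>. It is the ambient group in
  which the (internal) direct sum of these subgroups is formed.
\<close>

definition add_maps ::
    "('r, 'l::ab_group_add, 'x) graded_scheme \<Rightarrow> ('m, 'l, 'r, 'y) gmodule_scheme \<Rightarrow>
      ('n, 'l, 'r, 'z) gmodule_scheme \<Rightarrow> ('m \<Rightarrow> 'n, 'l) graded" where
  "add_maps R M N =
     \<lparr>carrier = hom (add_monoid M) (add_monoid N) \<inter> extensional (carrier M),
      mult = undefined, one = undefined,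
      zero = (\<lambda>x\<in>carrier M. \<zero>\<^bsub>N\<^esub>),
      add = (\<lambda>f g. \<lambda>x\<in>carrier M. f x \<oplus>\<^bsub>N\<^esub> g x),
      gpart = homL_part R M N\<rparr>"

text \<open>
  For an \<open>(R, S)\<close>-bimodule \<open>M\<close> and an \<open>(R, T)\<close>-bimodule \<open>N\<close>, this is the \<open>(S, T)\<close>-bimodule
  \<open>HOM\<^sup>L\<^sub>R(M, N)\<close>. For homogeneous \<open>a \<in> S\<close>, \<open>b \<in> T\<close>, \<open>f\<close> and \<open>x \<in> M\<close> of parities
  \<open>p a\<close>, \<open>p b\<close>, \<open>p f\<close>, \<open>p x\<close> the actions are
  \<open>(a \<cdot> f)(x) = (-1)\<^bsup>p a * p f + p a * p x\<^esup> f(x \<cdot> a)\<close> and \<open>(f \<cdot> b)(x) = (-1)\<^bsup>p b * p x\<^esup> f(x) \<cdot> b\<close>.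
\<close>

definition HOML ::
    "('r, 'l::ab_group_add) graded \<Rightarrow> ('s, 'l) graded \<Rightarrow> ('t, 'l) graded \<Rightarrow>
      ('m, 'l, 'r, 's) gbimodule \<Rightarrow> ('n, 'l, 'r, 't) gbimodule \<Rightarrow>
      ('m \<Rightarrow> 'n, 'l, 's, 't) gbimodule" where
  "HOML R S T M N =
     \<lparr>carrier = {f. \<exists>c. homog_decomp (add_maps R M N) f c},
      mult = undefined, one = undefined,
      zero = zero (add_maps R M N), add = add (add_maps R M N),
      gpart = homL_part R M N,
      lact = (\<lambda>a f. \<lambda>x\<in>carrier M.
        add_extend S N (\<lambda>d a'.
          add_extend (add_maps R M N) N (\<lambda>e f'.
            add_extend M N (\<lambda>g x'.
              sgn_act N (snd d * snd e + snd d * snd g) (f' (ract M x' a'))) x) f) a),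
      ract = (\<lambda>f b. \<lambda>x\<in>carrier M.
        add_extend T N (\<lambda>d b'.
          add_extend M N (\<lambda>g x'.
            sgn_act N (snd d * snd g) (ract N (f x') b')) x) b)\<rparr>"


section \<open>Twisted Frobenius extensions\<close>

text \<open>The \<open>(A, B)\<close>-bimodule \<open>HOM\<^sup>L\<^sub>B({}\<^sup>\<beta>\<^sub>BA\<^sup>\<alpha>\<^sub>A, {lam, \<pi>}\<^sub>BB\<^sub>B)\<close>.\<close>

definition frobenius_dual ::
    "('a, 'l::ab_group_add) graded \<Rightarrow> 'a set \<Rightarrow> ('a \<Rightarrow> 'a) \<Rightarrow> ('a \<Rightarrow> 'a) \<Rightarrow> 'l \<Rightarrow> bit \<Rightarrow>
      ('a \<Rightarrow> 'a, 'l, 'a, 'a) gbimodule" where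
  "frobenius_dual A B \<alpha> \<beta> lam \<pi> =
     HOML (grestrict A B) A (grestrict A B)
       (twisted_bimodule A \<beta> \<alpha>)
       (shift (grestrict A B) lam \<pi> (mult_bimodule (grestrict A B)))"

text \<open>\<open>A\<close> is an \<open>(\<alpha>, \<beta>)\<close>-Frobenius extension of \<open>B\<close> of degree \<open>(- lam, \<pi>)\<close>; mind the sign.\<close>

definition frobenius_extension ::
    "('a, 'l::ab_group_add) graded \<Rightarrow> 'a set \<Rightarrow> ('a \<Rightarrow> 'a) \<Rightarrow> ('a \<Rightarrow> 'a) \<Rightarrow> 'l \<Rightarrow> bit \<Rightarrow> bool" where
  "frobenius_extension A B \<alpha> \<beta> lam \<pi> \<longleftrightarrow>
     fin_gen_module (grestrict A B) (mult_bimodule A) \<and>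
     projective_module (grestrict A B) (mult_bimodule A) \<and>
     gbimodule_iso A (grestrict A B) (mult_bimodule A) (frobenius_dual A B \<alpha> \<beta> lam \<pi>) \<noteq> {}"

end

theory Submission
  imports Defs
begin

text \<open>
  The composite \<open>\<Psi> = \<Phi>\<inverse>\<Phi>'\<close> is an automorphism of the bimodule \<open>\<^sub>AA\<^sub>B\<close>, hence right multiplication
  by \<open>\<mu> = \<Psi>(1)\<close>; surjectivity gives a left inverse of \<open>\<mu>\<close>, injectivity makes it two-sided, and
  right \<open>B\<close>-linearity makes \<open>\<mu>\<close> commute with \<open>B\<close>. The only point that depends on the dual itself is
  that \<open>\<Phi>\<inverse>\<close> preserves degrees: evaluating \<open>\<Phi>\<close> at a homogeneous \<open>x\<close> gives a homogeneous map from
  \<open>A\<close> to \<open>B\<close>, so the components of \<open>\<mu>\<close> outside degree \<open>0\<close> are sent to maps vanishing on all homogeneous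
  elements.
\<close>

section \<open>Homogeneous components in a graded group\<close>

context graded_group
begin

lemma gpart_closed: "x \<in> gpart M d \<Longrightarrow> x \<in> carrier M"
  using additive_subgroup.a_Hcarr[OF gpart_subgroup] .

lemma zero_gpart: "\<zero> \<in> gpart M d"
  using additive_subgroup.zero_closed[OF gpart_subgroup] .

lemma homog_decomp_gcomp: "x \<in> carrier M \<Longrightarrow> homog_decomp M x (gcomp M x)"
  using theI'[OF unique_decomp] by (simp add: gcomp_def)

text \<open>The set \<open>D\<close> may exceed the support of \<open>c\<close>: zero terms do not
  change the sum, and uniqueness of the decomposition does the rest.\<close>

lemma gcomp_eqI:
  assumes "finite D" and c: "\<And>d. c d \<in> gpart M d" and z: "\<And>d. d \<notin> D \<Longrightarrow> c d = \<zero>"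
    and x: "x = (\<Oplus>d\<in>D. c d)"
  shows "gcomp M x = c"
proof -
  have sub: "{d. c d \<noteq> \<zero>} \<subseteq> D"
    using z by auto
  have "(\<Oplus>d\<in>{d. c d \<noteq> \<zero>}. c d) = (\<Oplus>d\<in>D. c d)"
    using sub assms(1) gpart_closed[OF c] by (intro add.finprod_mono_neutral_cong_left) (simp_all add: Pi_def)
  moreover have "finite {d. c d \<noteq> \<zero>}"
    using sub assms(1) by (rule finite_subset)
  ultimately have "homog_decomp M x c"
    using c x by (simp add: homog_decomp_def)
  moreover have "x \<in> carrier M"
    unfolding x using gpart_closed[OF c] by (intro finsum_closed) (simp add: Pi_def)
  ultimately show ?thesis
    unfolding gcomp_def using unique_decomp by (blast intro: the1_equality)
qed

lemma gcomp_homog: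
  assumes "x \<in> gpart M d"
  shows "gcomp M x = (\<lambda>e. if e = d then x else \<zero>)"
  using assms zero_gpart gpart_closed by (intro gcomp_eqI[of "{d}"]) auto

lemma gcomp_gpart: "x \<in> carrier M \<Longrightarrow> gcomp M x d \<in> gpart M d"
  using homog_decomp_gcomp[of x] unfolding homog_decomp_def by blast

text \<open>Only the term in degree \<open>d\<close> survives in the decomposition. The case of
  \<open>x\<close> zero is covered, since zero lies in every part.\<close>

lemma homogI:
  assumes "x \<in> carrier M" and "\<And>e. e \<noteq> d \<Longrightarrow> gcomp M x e = \<zero>"
  shows "x \<in> gpart M d"
proof -
  have cd: "gcomp M x d \<in> gpart M d"
    using assms(1) by (rule gcomp_gpart)
  have "x = (\<Oplus>e\<in>{e. gcomp M x e \<noteq> \<zero>}. gcomp M x e)"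
    using homog_decomp_gcomp[OF assms(1)] by (simp add: homog_decomp_def)
  also have "\<dots> = (\<Oplus>e\<in>{d}. gcomp M x e)"
    using assms gpart_closed[OF gcomp_gpart[OF assms(1)]] homog_decomp_gcomp[OF assms(1)]
    by (intro add.finprod_mono_neutral_cong_left) (auto simp: homog_decomp_def simp del: split_paired_All)
  also have "\<dots> = gcomp M x d"
    using gpart_closed[OF cd] by simp
  finally show ?thesis
    using cd by simp
qed

text \<open>Every element is a finite sum of its components, so induction over the degrees suffices;
  the empty sum falls under \<open>homog\<close>, zero being homogeneous.\<close>

lemma homog_induct [consumes 1, case_names homog add]:
  assumes "x \<in> carrier M"
    and h: "\<And>d y. y \<in> gpart M d \<Longrightarrow> P y"
    and a: "\<And>y z. \<lbrakk>y \<in> carrier M; z \<in> carrier M; P y; P z\<rbrakk> \<Longrightarrow> P (y \<oplus> z)"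
  shows "P x"
proof -
  have "P (\<Oplus>d\<in>D. gcomp M x d)" if "finite D" for D
    using that
  proof induction
    case empty
    show ?case using h[OF zero_gpart] by simp
  next
    case (insert d D)
    have "gcomp M x e \<in> gpart M e" for e
      using assms(1) by (rule gcomp_gpart)
    then have "gcomp M x e \<in> carrier M" "P (gcomp M x e)" for e
      using gpart_closed h by blast+
    then show ?case
      using insert a by (simp add: Pi_def)
  qed
  from this[of "{d. gcomp M x d \<noteq> \<zero>}"] show ?thesis
    using homog_decomp_gcomp[OF assms(1)] by (simp add: homog_decomp_def)
qed

end

section \<open>Additive and homogeneous maps on components\<close>

lemma (in abelian_group_hom) hom_finsum:
  "f \<in> S \<rightarrow> carrier G \<Longrightarrow> h (\<Oplus>\<^bsub>G\<^esub>i\<in>S. f i) = (\<Oplus>\<^bsub>H\<^esub>i\<in>S. h (f i))"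
  by (induction S rule: infinite_finite_induct) (simp_all add: Pi_def)

text \<open>The images of the components of \<open>x\<close>, with degrees moved by
  \<open>s\<close>, form a decomposition of \<open>f x\<close>, and decompositions are
  unique.\<close>

lemma homog_map_gcomp:
  assumes "graded_group M" and "graded_group N" and f: "f \<in> homog_map M N s" and x: "x \<in> carrier M"
  shows "gcomp N (f x) (d + s) = f (gcomp M x d)"
proof -
  interpret M: graded_group M by fact
  interpret N: graded_group N by fact
  interpret f: abelian_group_hom M N f
    using f by (intro abelian_group_homI M.abelian_group_axioms N.abelian_group_axioms)
      (simp add: group_hom_def group_hom_axioms_def M.a_group N.a_group homog_map_def)
  let ?c = "gcomp M x"
  let ?D = "{d. ?c d \<noteq> \<zero>\<^bsub>M\<^esub>}"
  have D: "finite ?D" "x = (\<Oplus>\<^bsub>M\<^esub>d\<in>?D. ?c d)"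
    using M.homog_decomp_gcomp[OF x] by (simp_all add: homog_decomp_def)
  have c: "?c d \<in> gpart M d" for d
    using x by (rule M.gcomp_gpart)
  then have fc: "f (?c d) \<in> gpart N (d + s)" for d
    using f unfolding homog_map_def by blast
  have "gcomp N (f x) = (\<lambda>e. f (?c (e - s)))"
  \<comment> \<open>As \<open>f\<close> may kill components, the translated support of
    \<open>x\<close> contains the support of \<open>f x\<close> but need not equal it.\<close>
  proof (rule N.gcomp_eqI[of "(\<lambda>d. d + s) ` ?D"])
    show "finite ((\<lambda>d. d + s) ` ?D)"
      using D(1) by simp
    show "f (?c (e - s)) \<in> gpart N e" for e
      using fc[of "e - s"] by simp
    show "f (?c (e - s)) = \<zero>\<^bsub>N\<^esub>" if "e \<notin> (\<lambda>d. d + s) ` ?D" for e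
    proof -
      have "e = (e - s) + s" by simp
      then have "?c (e - s) = \<zero>\<^bsub>M\<^esub>" using that by blast
      then show ?thesis by simp
    qed
    have "f x = (\<Oplus>\<^bsub>N\<^esub>d\<in>?D. f (?c d))"
      using D M.gpart_closed[OF c] f.hom_finsum[of ?c ?D] by (simp add: Pi_def)
    also have "\<dots> = (\<Oplus>\<^bsub>N\<^esub>e\<in>(\<lambda>d. d + s) ` ?D. f (?c (e - s)))"
      using N.gpart_closed[OF fc] by (subst N.add.finprod_reindex) (simp_all add: inj_on_def Pi_def)
    finally show "f x = (\<Oplus>\<^bsub>N\<^esub>e\<in>(\<lambda>d. d + s) ` ?D. f (?c (e - s)))" .
  qed
  then show ?thesis by simp
qed

section \<open>Evaluation of the dual at homogeneous elements\<close>

text \<open>Addition and subtraction coincide in \<open>bit\<close>, so both coordinates of the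
  degree are translated in the same direction.\<close>

lemma gpart_shift: "gpart (shift R \<mu> \<gamma> M) d = gpart M (d - (\<mu>, \<gamma>))"
  by (cases d) (simp add: shift_def)

text \<open>For \<open>a\<close> of degree \<open>d\<close>, the map \<open>\<Phi> a\<close> sends
  degree \<open>e\<close> to degree \<open>e + d\<close> of the shift, which is degree
  \<open>d + (e - (lam, \<pi>))\<close> of \<open>B\<close>; with \<open>x\<close> fixed, this is
  homogeneity in \<open>a\<close>. The carrier of the dual is given through decompositions only, so
  additivity of \<open>\<Phi> a\<close> is read off for homogeneous \<open>a\<close> and extended by
  additivity of \<open>\<Phi>\<close>.\<close>

lemma frobenius_dual_eval_homog:
  assumes A: "graded_superring A" and B: "graded_superring (grestrict A B)"
    and \<Phi>: "\<Phi> \<in> homog_map (mult_bimodule A) (frobenius_dual A B \<alpha> \<beta> lam \<pi>) 0"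
  shows "a \<in> carrier A \<Longrightarrow>
      \<Phi> a \<in> hom (add_monoid A) (add_monoid (grestrict A B)) \<inter> extensional (carrier A)"
    and "x \<in> gpart A e \<Longrightarrow> (\<lambda>a. \<Phi> a x) \<in> homog_map A (grestrict A B) (e - (lam, \<pi>))"
proof -
  interpret A: graded_superring A by fact
  interpret B: graded_superring "grestrict A B" by fact
  let ?H = "hom (add_monoid A) (add_monoid (grestrict A B)) \<inter> extensional (carrier A)"
  have \<Phi>_add: "\<Phi> (a \<oplus>\<^bsub>A\<^esub> b) = (\<lambda>x\<in>carrier A. \<Phi> a x \<oplus>\<^bsub>A\<^esub> \<Phi> b x)"
    if "a \<in> carrier A" "b \<in> carrier A" for a b
    using \<Phi> that by (simp add: homog_map_def hom_def frobenius_dual_def HOML_def add_maps_def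
        mult_bimodule_def twisted_bimodule_def shift_def grestrict_def)
  have part: "\<Phi> a \<in> ?H" "\<And>x e. x \<in> gpart A e \<Longrightarrow> \<Phi> a x \<in> gpart (grestrict A B) (d + (e - (lam, \<pi>)))"
    if "a \<in> gpart A d" for a d
  proof -
    have *: "\<Phi> a \<in> homL_part (grestrict A B) (twisted_bimodule A \<beta> \<alpha>)
       (shift (grestrict A B) lam \<pi> (mult_bimodule (grestrict A B))) d"
      using \<Phi> that
      by (simp add: homog_map_def frobenius_dual_def HOML_def mult_bimodule_def image_subset_iff
          del: split_paired_All)
    then show "\<Phi> a \<in> ?H"
      by (simp add: homL_part_def homog_map_def hom_def
        mult_bimodule_def twisted_bimodule_def shift_def grestrict_def)
    fix x e assume "x \<in> gpart A e"
    then have "\<Phi> a x \<in> gpart (shift (grestrict A B) lam \<pi> (mult_bimodule (grestrict A B))) (e + d)"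
      using *
      by (simp add: homL_part_def homog_map_def twisted_bimodule_def mult_bimodule_def
          image_subset_iff del: split_paired_All)
    then show "\<Phi> a x \<in> gpart (grestrict A B) (d + (e - (lam, \<pi>)))"
      by (simp add: gpart_shift mult_bimodule_def algebra_simps)
  qed
  show H: "\<Phi> a \<in> ?H" if "a \<in> carrier A" for a
    using that
  proof (induction rule: A.homog_induct)
    case (homog d y)
    then show ?case by (rule part)
  next
    case (add y z)
    have "(\<lambda>x\<in>carrier A. \<Phi> y x \<oplus>\<^bsub>A\<^esub> \<Phi> z x) \<in> ?H"
      using add(3,4) B.a_closed B.add.m_assoc B.add.m_comm B.add.m_lcomm
      by (auto simp: hom_def Pi_def grestrict_def)
    then show ?case using \<Phi>_add[OF add(1,2)] by (simp only:)
  qed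
  show "(\<lambda>a. \<Phi> a x) \<in> homog_map A (grestrict A B) (e - (lam, \<pi>))" if "x \<in> gpart A e"
  proof -
    have "(\<lambda>a. \<Phi> a x) \<in> hom (add_monoid A) (add_monoid (grestrict A B))"
      using H \<Phi>_add A.gpart_closed[OF that] by (simp add: hom_def Pi_def grestrict_def)
    then show ?thesis
      unfolding homog_map_def using part(2)[OF _ that] by blast
  qed
qed

text \<open>Evaluation at a homogeneous \<open>x\<close> moves the question into the grading of
  \<open>B\<close>: the component of \<open>a\<close> in a degree other than \<open>d\<close>
  becomes a component of the homogeneous element \<open>\<Phi> a x\<close> in a wrong degree, hence
  zero. So \<open>\<Phi>\<close> sends that component to the zero map, and injectivity removes
  it.\<close>

lemma frobenius_dual_reflects_degree:
  assumes A: "graded_superring A" and B: "graded_superring (grestrict A B)"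
    and \<Phi>: "\<Phi> \<in> homog_map (mult_bimodule A) (frobenius_dual A B \<alpha> \<beta> lam \<pi>) 0"
    and inj: "inj_on \<Phi> (carrier A)"
    and a: "a \<in> carrier A" and deg: "\<Phi> a \<in> gpart (frobenius_dual A B \<alpha> \<beta> lam \<pi>) d"
  shows "a \<in> gpart A d"
proof -
  interpret A: graded_superring A by fact
  interpret B: graded_superring "grestrict A B" by fact
  note ev = frobenius_dual_eval_homog[OF A B \<Phi>]
  have zeroB: "\<zero>\<^bsub>grestrict A B\<^esub> = \<zero>\<^bsub>A\<^esub>"
    by (simp add: grestrict_def)
  have hom_zero: "h \<zero>\<^bsub>A\<^esub> = \<zero>\<^bsub>A\<^esub>" if "h \<in> hom (add_monoid A) (add_monoid (grestrict A B))" for h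
    using group_hom.hom_one[OF group_hom.intro[OF A.a_group B.a_group group_hom_axioms.intro[OF that]]]
    by (simp add: grestrict_def)
  have eval_zero: "\<Phi> \<zero>\<^bsub>A\<^esub> x = \<zero>\<^bsub>A\<^esub>" if "x \<in> gpart A e" for x e
    using ev(2)[OF that] by (intro hom_zero) (simp add: homog_map_def)
  \<comment> \<open>Homogeneous elements determine an additive map on the carrier;
    \<open>extensional\<close> turns this into equality of functions, as injectivity of
    \<open>\<Phi>\<close> requires.\<close>
  have hom_ext: "h = k"
    if h: "h \<in> hom (add_monoid A) (add_monoid (grestrict A B)) \<inter> extensional (carrier A)"
      and k: "k \<in> hom (add_monoid A) (add_monoid (grestrict A B)) \<inter> extensional (carrier A)"
      and hk: "\<And>x e. x \<in> gpart A e \<Longrightarrow> h x = k x" for h k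
  proof (rule extensionalityI[of _ "carrier A"])
    show "h x = k x" if "x \<in> carrier A" for x
      using that
    proof (induction rule: A.homog_induct)
      case (homog e y)
      then show ?case by (rule hk)
    next
      case (add y z)
      then show ?case using h k by (simp add: hom_def)
    qed
  qed (use h k in auto)
  show ?thesis
  proof (rule A.homogI[OF a])
    fix c assume c: "c \<noteq> d"
    have ac: "gcomp A a c \<in> carrier A"
      using A.gpart_closed[OF A.gcomp_gpart[OF a]] .
    have "\<Phi> (gcomp A a c) x = \<zero>\<^bsub>A\<^esub>" if x: "x \<in> gpart A e" for x e
    proof -
      have "\<Phi> a x \<in> gpart (shift (grestrict A B) lam \<pi> (mult_bimodule (grestrict A B))) (e + d)"
        using deg x by (simp add: frobenius_dual_def HOML_def homL_part_def homog_map_def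
            twisted_bimodule_def mult_bimodule_def image_subset_iff del: split_paired_All)
      then have "\<Phi> a x \<in> gpart (grestrict A B) (d + (e - (lam, \<pi>)))"
        by (simp add: gpart_shift mult_bimodule_def algebra_simps)
      \<comment> \<open>The degrees \<open>c\<close> and \<open>d\<close> stay distinct after adding
        the same offset.\<close>
      then have "gcomp (grestrict A B) (\<Phi> a x) (c + (e - (lam, \<pi>))) = \<zero>\<^bsub>A\<^esub>"
        using c by (simp add: B.gcomp_homog zeroB)
      then show ?thesis
        using homog_map_gcomp[OF A.graded_group_axioms B.graded_group_axioms ev(2)[OF x] a] by simp
    qed
    then have "\<Phi> (gcomp A a c) = \<Phi> \<zero>\<^bsub>A\<^esub>"
      using eval_zero by (intro hom_ext ev(1) ac A.zero_closed) auto
    then show "gcomp A a c = \<zero>\<^bsub>A\<^esub>"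
      using inj ac by (simp add: inj_on_eq_iff)
  qed
qed

section \<open>Isomorphisms and right multiplication by units\<close>

theorem proposition3p8:
  fixes A :: "('a, 'l::ab_group_add) graded"
    and B :: "'a set"
    and \<alpha> \<beta> :: "'a \<Rightarrow> 'a"
    and lam :: 'l
    and \<pi> :: bit
    and \<Phi> \<Phi>' :: "'a \<Rightarrow> 'a \<Rightarrow> 'a"
  assumes "graded_superring A"
    and "graded_subring B A"
    and "\<alpha> \<in> graded_automorphisms A"
    and "\<beta> \<in> graded_automorphisms (grestrict A B)"
    and "frobenius_extension A B \<alpha> \<beta> lam \<pi>"
    and "\<Phi> \<in> gbimodule_iso A (grestrict A B) (mult_bimodule A) (frobenius_dual A B \<alpha> \<beta> lam \<pi>)"
    and "\<Phi>' \<in> carrier A \<rightarrow> carrier (frobenius_dual A B \<alpha> \<beta> lam \<pi>)"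
  shows "\<Phi>' \<in> gbimodule_iso A (grestrict A B) (mult_bimodule A) (frobenius_dual A B \<alpha> \<beta> lam \<pi>)
    \<longleftrightarrow> (\<exists>\<mu>. \<mu> \<in> Units A \<and> \<mu> \<in> gpart A (0, 0) \<and>
          (\<forall>b\<in>B. \<mu> \<otimes>\<^bsub>A\<^esub> b = b \<otimes>\<^bsub>A\<^esub> \<mu>) \<and>
          (\<forall>a\<in>carrier A. inv_into (carrier A) \<Phi> (\<Phi>' a) = a \<otimes>\<^bsub>A\<^esub> \<mu>))"
proof -
  interpret A: graded_superring A by fact
  let ?R = "grestrict A B"
  let ?N = "frobenius_dual A B \<alpha> \<beta> lam \<pi>"
  let ?\<Psi> = "\<lambda>a. inv_into (carrier A) \<Phi> (\<Phi>' a)"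
  have subB: "subring B A" and gB: "graded_superring ?R"
    using assms(2) by (auto simp: graded_subring_def)
  have BA: "b \<in> carrier A" if "b \<in> B" for b
    using subringE(1)[OF subB] that by blast
  \<comment> \<open>The operations of the dual stay folded: apart from the degree of
    \<open>\<mu>\<close>, these five laws are all that is used of it.\<close>
  have iso_iff: "f \<in> gbimodule_iso A ?R (mult_bimodule A) ?N \<longleftrightarrow>
      bij_betw f (carrier A) (carrier ?N) \<and>
      (\<forall>a\<in>carrier A. \<forall>b\<in>carrier A. f (a \<oplus>\<^bsub>A\<^esub> b) = f a \<oplus>\<^bsub>?N\<^esub> f b) \<and>
      (\<forall>d. f ` gpart A d \<subseteq> gpart ?N d) \<and>
      (\<forall>r\<in>carrier A. \<forall>a\<in>carrier A. f (r \<otimes>\<^bsub>A\<^esub> a) = lact ?N r (f a)) \<and>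
      (\<forall>a\<in>carrier A. \<forall>b\<in>B. f (a \<otimes>\<^bsub>A\<^esub> b) = ract ?N (f a) b)" for f
    by (auto simp: gbimodule_iso_def gbimodule_hom_def gmodule_hom_def homog_map_def hom_def
        mult_bimodule_def grestrict_def dest: bij_betw_apply)
  note \<Phi> = assms(6)[unfolded iso_iff]
  have bij: "bij_betw \<Phi> (carrier A) (carrier ?N)"
    using \<Phi> by blast
  have \<Phi>_inj: "\<Phi> a = \<Phi> b \<Longrightarrow> a = b" if "a \<in> carrier A" "b \<in> carrier A" for a b
    using bij that by (auto simp: bij_betw_def inj_on_def)
  \<comment> \<open>Since \<open>\<Phi>'\<close> maps into the carrier of the dual,
    \<open>\<Phi>' a\<close> lies in the image of \<open>\<Phi>\<close>, where
    \<open>inv_into\<close> is a true inverse.\<close>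
  have \<Phi>_\<Psi>: "\<Phi> (?\<Psi> a) = \<Phi>' a" and \<Psi>_closed: "?\<Psi> a \<in> carrier A" if "a \<in> carrier A" for a
    using bij_betw_inv_into_right[OF bij] bij_betw_apply[OF bij_betw_inv_into[OF bij]]
      funcset_mem[OF assms(7) that] by blast+
  show ?thesis
  proof
    assume "\<Phi>' \<in> gbimodule_iso A ?R (mult_bimodule A) ?N"
    note \<Phi>' = this[unfolded iso_iff]
    \<comment> \<open>Under \<open>\<Phi>\<close> both sides become
      \<open>lact ?N a (\<Phi>' x)\<close>.\<close>
    have \<Psi>_mult: "?\<Psi> (a \<otimes>\<^bsub>A\<^esub> x) = a \<otimes>\<^bsub>A\<^esub> ?\<Psi> x" if "a \<in> carrier A" "x \<in> carrier A" for a x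
      using that \<Phi> \<Phi>' \<Psi>_closed \<Phi>_\<Psi>[of "a \<otimes>\<^bsub>A\<^esub> x"] \<Psi>_closed[of "a \<otimes>\<^bsub>A\<^esub> x"]
      by (intro \<Phi>_inj) (simp_all add: \<Phi>_\<Psi>)
    have \<Psi>_ract: "?\<Psi> (a \<otimes>\<^bsub>A\<^esub> b) = ?\<Psi> a \<otimes>\<^bsub>A\<^esub> b" if "a \<in> carrier A" "b \<in> B" for a b
    proof (rule \<Phi>_inj)
      have "\<Phi> (?\<Psi> (a \<otimes>\<^bsub>A\<^esub> b)) = \<Phi>' (a \<otimes>\<^bsub>A\<^esub> b)"
        using that BA by (intro \<Phi>_\<Psi>) simp
      also have "\<dots> = ract ?N (\<Phi> (?\<Psi> a)) b"
        using \<Phi>' that by (simp only: \<Phi>_\<Psi>)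
      also have "\<dots> = \<Phi> (?\<Psi> a \<otimes>\<^bsub>A\<^esub> b)"
        using \<Phi> \<Psi>_closed that by simp
      finally show "\<Phi> (?\<Psi> (a \<otimes>\<^bsub>A\<^esub> b)) = \<Phi> (?\<Psi> a \<otimes>\<^bsub>A\<^esub> b)" .
    qed (use that BA \<Psi>_closed in simp_all)
    define \<mu> where "\<mu> = ?\<Psi> \<one>\<^bsub>A\<^esub>"
    have \<mu>: "\<mu> \<in> carrier A"
      unfolding \<mu>_def by (intro \<Psi>_closed) simp
    have \<Psi>_eq: "?\<Psi> a = a \<otimes>\<^bsub>A\<^esub> \<mu>" if "a \<in> carrier A" for a
      using \<Psi>_mult[OF that A.one_closed] that by (simp add: \<mu>_def)
    \<comment> \<open>The element \<open>\<nu>\<close> is the preimage of 1 under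
      \<open>?\<Psi>\<close>, so the formula for \<open>?\<Psi>\<close> makes it a left inverse of
      \<open>\<mu>\<close>.\<close>
    have "\<Phi> \<one>\<^bsub>A\<^esub> \<in> carrier ?N"
      using bij by (auto dest: bij_betw_apply)
    then obtain \<nu> where \<nu>: "\<nu> \<in> carrier A" "\<Phi>' \<nu> = \<Phi> \<one>\<^bsub>A\<^esub>"
      using \<Phi>' unfolding bij_betw_def by (metis imageE)
    have \<nu>\<mu>: "\<nu> \<otimes>\<^bsub>A\<^esub> \<mu> = \<one>\<^bsub>A\<^esub>"
      using \<Psi>_eq[OF \<nu>(1)] \<nu>(2) bij_betw_inv_into_left[OF bij A.one_closed] by simp
    \<comment> \<open>Both sides equal \<open>\<mu>\<close>, because
      \<open>\<mu>\<nu>\<mu> = \<mu>\<close>; injectivity of \<open>\<Phi>'\<close> then gives the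
      right inverse.\<close>
    have "?\<Psi> (\<mu> \<otimes>\<^bsub>A\<^esub> \<nu>) = ?\<Psi> \<one>\<^bsub>A\<^esub>"
      using \<mu> \<nu>(1) \<nu>\<mu> by (simp add: \<Psi>_eq A.m_assoc)
    then have "\<Phi>' (\<mu> \<otimes>\<^bsub>A\<^esub> \<nu>) = \<Phi>' \<one>\<^bsub>A\<^esub>"
      using \<Phi>_\<Psi> \<mu> \<nu>(1) by (metis A.m_closed A.one_closed)
    then have \<mu>\<nu>: "\<mu> \<otimes>\<^bsub>A\<^esub> \<nu> = \<one>\<^bsub>A\<^esub>"
      using \<Phi>' \<mu> \<nu>(1) by (auto simp: bij_betw_def inj_on_def)
    have "\<mu> \<in> Units A"
      using \<mu> \<nu>(1) \<nu>\<mu> \<mu>\<nu> by (auto simp: Units_def)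
    moreover have "\<mu> \<in> gpart A (0, 0)"
    proof (rule frobenius_dual_reflects_degree[OF assms(1) gB _ _ \<mu>])
      show "\<Phi> \<in> homog_map (mult_bimodule A) ?N 0"
        using assms(6) by (simp add: gbimodule_iso_def gbimodule_hom_def gmodule_hom_def)
      show "inj_on \<Phi> (carrier A)"
        using bij by (simp add: bij_betw_def)
      \<comment> \<open>\<open>\<Phi>'\<close> preserves the degree 0 of the unit element, and
        \<open>\<Phi>\<close> reflects it back to \<open>\<mu>\<close>.\<close>
      have "\<Phi> \<mu> = \<Phi>' \<one>\<^bsub>A\<^esub>"
        unfolding \<mu>_def by (rule \<Phi>_\<Psi>) simp
      then show "\<Phi> \<mu> \<in> gpart ?N (0, 0)"
        using \<Phi>' A.one_homog by (simp add: zero_prod_def image_subset_iff)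
    qed
    \<comment> \<open>Both sides are \<open>?\<Psi> b\<close>: the left one by right linearity at 1,
      the right one by the formula for \<open>?\<Psi>\<close>.\<close>
    moreover have "\<forall>b\<in>B. \<mu> \<otimes>\<^bsub>A\<^esub> b = b \<otimes>\<^bsub>A\<^esub> \<mu>"
      using \<Psi>_ract[OF A.one_closed, folded \<mu>_def] BA by (simp add: \<Psi>_eq)
    ultimately show "\<exists>\<mu>. \<mu> \<in> Units A \<and> \<mu> \<in> gpart A (0, 0) \<and>
          (\<forall>b\<in>B. \<mu> \<otimes>\<^bsub>A\<^esub> b = b \<otimes>\<^bsub>A\<^esub> \<mu>) \<and> (\<forall>a\<in>carrier A. ?\<Psi> a = a \<otimes>\<^bsub>A\<^esub> \<mu>)"
      using \<Psi>_eq by blast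
  next
    assume "\<exists>\<mu>. \<mu> \<in> Units A \<and> \<mu> \<in> gpart A (0, 0) \<and>
          (\<forall>b\<in>B. \<mu> \<otimes>\<^bsub>A\<^esub> b = b \<otimes>\<^bsub>A\<^esub> \<mu>) \<and> (\<forall>a\<in>carrier A. ?\<Psi> a = a \<otimes>\<^bsub>A\<^esub> \<mu>)"
    then obtain \<mu> where unit: "\<mu> \<in> Units A" and deg: "\<mu> \<in> gpart A 0"
      and comm: "\<And>b. b \<in> B \<Longrightarrow> \<mu> \<otimes>\<^bsub>A\<^esub> b = b \<otimes>\<^bsub>A\<^esub> \<mu>"
      and \<Psi>_eq: "\<And>a. a \<in> carrier A \<Longrightarrow> ?\<Psi> a = a \<otimes>\<^bsub>A\<^esub> \<mu>"
      by (auto simp: zero_prod_def)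
    have \<mu>: "\<mu> \<in> carrier A"
      using unit by (rule A.Units_closed)
    have \<Phi>'_eq: "\<Phi>' a = \<Phi> (a \<otimes>\<^bsub>A\<^esub> \<mu>)" if "a \<in> carrier A" for a
      using \<Phi>_\<Psi>[OF that] \<Psi>_eq[OF that] by simp
    have "bij_betw (\<lambda>a. a \<otimes>\<^bsub>A\<^esub> \<mu>) (carrier A) (carrier A)"
      using unit \<mu> by (intro bij_betw_byWitness[where f' = "\<lambda>a. a \<otimes>\<^bsub>A\<^esub> inv\<^bsub>A\<^esub> \<mu>"])
        (auto simp: A.m_assoc)
    from bij_betw_trans[OF this bij]
    have "bij_betw \<Phi>' (carrier A) (carrier ?N)"
      by (rule bij_betw_cong[THEN iffD1, rotated]) (simp add: \<Phi>'_eq)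
    moreover have "\<Phi>' (a \<oplus>\<^bsub>A\<^esub> b) = \<Phi>' a \<oplus>\<^bsub>?N\<^esub> \<Phi>' b" if "a \<in> carrier A" "b \<in> carrier A" for a b
      using that \<mu> \<Phi> by (simp add: \<Phi>'_eq A.l_distr)
    moreover have "\<Phi>' a \<in> gpart ?N d" if "a \<in> gpart A d" for a d
      using that \<Phi> A.mult_homog[OF that deg] A.gpart_closed[OF that]
      by (simp add: \<Phi>'_eq image_subset_iff del: split_paired_All)
    moreover have "\<Phi>' (r \<otimes>\<^bsub>A\<^esub> a) = lact ?N r (\<Phi>' a)" if "r \<in> carrier A" "a \<in> carrier A" for r a
      using that \<mu> \<Phi> by (simp add: \<Phi>'_eq A.m_assoc)
    moreover have "\<Phi>' (a \<otimes>\<^bsub>A\<^esub> b) = ract ?N (\<Phi>' a) b" if "a \<in> carrier A" "b \<in> B" for a b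
    proof -
      \<comment> \<open>Commutation with \<open>b\<close> brings \<open>b\<close> to the far right,
        where right linearity of \<open>\<Phi>\<close> applies.\<close>
      have "\<Phi>' (a \<otimes>\<^bsub>A\<^esub> b) = \<Phi> (a \<otimes>\<^bsub>A\<^esub> \<mu> \<otimes>\<^bsub>A\<^esub> b)"
        using that \<mu> BA by (simp add: \<Phi>'_eq A.m_assoc comm)
      then show ?thesis
        using that \<mu> \<Phi> by (simp add: \<Phi>'_eq)
    qed
    ultimately show "\<Phi>' \<in> gbimodule_iso A ?R (mult_bimodule A) ?N"
      by (auto simp: iso_iff)
  qed
qed

end
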